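(* Let $f:(\mathbb R^2,a)\to(\mathbb C,f(a))$ be a smooth ($C^\infty$) map defined near $a$, with Jacobian determinant $J$. Define recursively $$M_1=\begin{vmatrix}\nabla_{\mathbb R}J\\ \nabla_{\mathbb R}f\end{vmatrix},\quad M_k=\begin{vmatrix}\nabla_{\mathbb R}J\\ \nabla_{\mathbb R}M_{k-1}\end{vmatrix}\ (k\ge2),\qquad L_1=\begin{vmatrix}\nabla f\\ \nabla J\end{vmatrix},\quad L_k=\begin{vmatrix}\nabla L_{k-1}\\ \nabla J\end{vmatrix}\ (k\ge2).$$ Then $M_n=(2i)^nL_n$ for all $n\ge1$. Let $\Gamma(t)$ be the trajectory of the vector field $(-J_y(z),J_x(z))$ with initial point $\Gamma(0)=a$, and set $\Sigma(t)=f(\Gamma(t))$. Then for all $n\ge1$, $$\Sigma^{(n)}(t)=M_n(\Gamma(t))=(2i)^nL_n(\Gamma(t)).$$ In particular $\Sigma^{(n)}(0)=M_n(a)=(2i)^nL_n(a)$.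
   Context: For a complex-valued smooth function $G$ on an open subset of $\mathbb R^2=\mathbb C$, $\nabla_{\mathbb R}G=(G_x,G_y)$ and $\nabla G=(G_z,G_{\bar z})=\big(\tfrac12(G_x-iG_y),\tfrac12(G_x+iG_y)\big)$. Vertical bars denote the $2\times2$ determinant with the indicated rows. $J$ is the (real-valued) Jacobian determinant of $f$ viewed as a map $\mathbb R^2\to\mathbb R^2$. *)

theory Defs
  imports "HOL-Analysis.Analysis"
begin

text \<open>
  The plane is identified with \<open>complex\<close>. A map defined near a point is a total function
  together with an open set on which it is assumed smooth; all derivatives below are taken at points
  of that open set, so they do not depend on the values elsewhere.
\<close>

primrec Ck_on :: "nat \<Rightarrow> ('a::real_normed_vector \<Rightarrow> 'b::real_normed_vector) \<Rightarrow> 'a set \<Rightarrow> bool" where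
  "Ck_on 0 f U \<longleftrightarrow> continuous_on U f"
| "Ck_on (Suc k) f U \<longleftrightarrow>
     (\<forall>x\<in>U. f differentiable (at x)) \<and> (\<forall>v. Ck_on k (\<lambda>x. frechet_derivative f (at x) v) U)"

text \<open>Meant for open \<open>U\<close> only, since derivatives are taken in a full neighbourhood.\<close>

definition smooth_on :: "('a::real_normed_vector \<Rightarrow> 'b::real_normed_vector) \<Rightarrow> 'a set \<Rightarrow> bool" where
  "smooth_on f U \<longleftrightarrow> (\<forall>k. Ck_on k f U)"

definition partial_x :: "(complex \<Rightarrow> 'b::real_normed_vector) \<Rightarrow> complex \<Rightarrow> 'b" where
  "partial_x G z = vector_derivative (\<lambda>t. G (z + of_real t)) (at 0)"

definition partial_y :: "(complex \<Rightarrow> 'b::real_normed_vector) \<Rightarrow> complex \<Rightarrow> 'b" where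
  "partial_y G z = vector_derivative (\<lambda>t. G (z + \<i> * of_real t)) (at 0)"

definition grad_real :: "(complex \<Rightarrow> complex) \<Rightarrow> complex \<Rightarrow> complex ^ 2" where
  "grad_real G z = vector [partial_x G z, partial_y G z]"

definition grad_wirtinger :: "(complex \<Rightarrow> complex) \<Rightarrow> complex \<Rightarrow> complex ^ 2" where
  "grad_wirtinger G z =
     vector [(partial_x G z - \<i> * partial_y G z) / 2, (partial_x G z + \<i> * partial_y G z) / 2]"

definition jacobian_det :: "(complex \<Rightarrow> complex) \<Rightarrow> complex \<Rightarrow> real" where
  "jacobian_det f z =
     det (vector [vector [partial_x (\<lambda>w. Re (f w)) z, partial_y (\<lambda>w. Re (f w)) z],
                  vector [partial_x (\<lambda>w. Im (f w)) z, partial_y (\<lambda>w. Im (f w)) z]] :: real ^ 2 ^ 2)"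

text \<open>
  Both sequences are indexed from 1; the value \<open>f\<close> at index 0 is a convention under which the
  first term and the recursive step are given by the same formula.
\<close>

primrec M :: "(complex \<Rightarrow> complex) \<Rightarrow> nat \<Rightarrow> complex \<Rightarrow> complex" where
  "M f 0 = f"
| "M f (Suc k) = (\<lambda>z. det (vector [grad_real (\<lambda>w. of_real (jacobian_det f w)) z,
                                   grad_real (M f k) z] :: complex ^ 2 ^ 2))"

primrec L :: "(complex \<Rightarrow> complex) \<Rightarrow> nat \<Rightarrow> complex \<Rightarrow> complex" where
  "L f 0 = f"
| "L f (Suc k) = (\<lambda>z. det (vector [grad_wirtinger (L f k) z,
                                   grad_wirtinger (\<lambda>w. of_real (jacobian_det f w)) z] :: complex ^ 2 ^ 2))"

definition trajectory_on ::
  "(complex \<Rightarrow> complex) \<Rightarrow> complex set \<Rightarrow> complex \<Rightarrow> real set \<Rightarrow> (real \<Rightarrow> complex) \<Rightarrow> bool" where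
  "trajectory_on X U a I \<Gamma> \<longleftrightarrow>
     open I \<and> is_interval I \<and> 0 \<in> I \<and> \<Gamma> 0 = a \<and>
     (\<forall>t\<in>I. \<Gamma> t \<in> U \<and> (\<Gamma> has_vector_derivative X (\<Gamma> t)) (at t))"

primrec nth_vector_derivative :: "nat \<Rightarrow> (real \<Rightarrow> 'b::real_normed_vector) \<Rightarrow> real \<Rightarrow> 'b" where
  "nth_vector_derivative 0 g = g"
| "nth_vector_derivative (Suc n) g = (\<lambda>t. vector_derivative (nth_vector_derivative n g) (at t))"

end

theory Submission
  imports Defs
begin

text \<open>
  Along the Hamiltonian field \<open>(-J\<^sub>y, J\<^sub>x)\<close> the time derivative of \<open>G \<circ> \<Gamma>\<close> is
  \<open>J\<^sub>x G\<^sub>y - J\<^sub>y G\<^sub>x\<close>, the determinant that produces \<open>M\<^sub>n\<^sub>+\<^sub>1\<close> from \<open>M\<^sub>n\<close>; expanding the Wirtinger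
  derivatives shows that the same expression is \<open>2\<i>\<close> times the determinant that defines the
  \<open>L\<^sub>n\<close>. Both facts iterate because all the functions involved are smooth on \<open>U\<close>.
\<close>

section \<open>Calculus of \<open>Ck_on\<close> and \<open>smooth_on\<close> on open sets\<close>

text \<open>Since \<open>U\<close> is open, agreement on \<open>U\<close> is agreement near each of
  its points, so the derivatives agree on \<open>U\<close> as well and the induction passes to
  them.\<close>

lemma Ck_on_cong:
  assumes "open U" "\<And>x. x \<in> U \<Longrightarrow> f x = g x" "Ck_on k f U"
  shows "Ck_on k g U"
  using assms(2,3)
proof (induction k arbitrary: f g)
  case 0
  then show ?case by (simp cong: continuous_on_cong)
next
  case (Suc k)
  have "(g has_derivative frechet_derivative f (at x)) (at x)" if "x \<in> U" for x
  proof (rule has_derivative_transform_within_open[OF _ \<open>open U\<close> that])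
    show "(f has_derivative frechet_derivative f (at x)) (at x)"
      using Suc.prems(2) that by (simp add: frechet_derivative_works)
  qed (use Suc.prems(1) in auto)
  then have "g differentiable (at x)"
    "frechet_derivative f (at x) = frechet_derivative g (at x)" if "x \<in> U" for x
    using that by (auto simp: differentiable_def dest: frechet_derivative_at)
  then show ?case
    using Suc.prems(2) Suc.IH[of "\<lambda>x. frechet_derivative f (at x) v"
        "\<lambda>x. frechet_derivative g (at x) v" for v] by simp
qed

text \<open>\<open>Ck_on\<close> speaks of \<open>frechet_derivative\<close>, while differentiation
  rules yield an explicit \<open>f'\<close>; uniqueness of derivatives identifies the two on
  \<open>U\<close>. The closure lemmas below rest on this rule.\<close>

lemma Ck_on_SucI:
  assumes "open U" "\<And>x. x \<in> U \<Longrightarrow> (f has_derivative f' x) (at x)"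
    and "\<And>v. Ck_on k (\<lambda>x. f' x v) U"
  shows "Ck_on (Suc k) f U"
proof -
  have "frechet_derivative f (at x) = f' x" if "x \<in> U" for x
    using frechet_derivative_at[OF assms(2)[OF that]] by simp
  then have "Ck_on k (\<lambda>x. frechet_derivative f (at x) v) U" for v
    by (intro Ck_on_cong[OF \<open>open U\<close> _ assms(3)[of v]]) simp
  then show ?thesis
    using assms(2) by (auto simp: differentiable_def)
qed

lemma Ck_on_Suc_imp_Ck_on: "Ck_on (Suc k) f U \<Longrightarrow> Ck_on k f U"
proof (induction k arbitrary: f)
  case 0
  then show ?case
    by (auto intro!: continuous_at_imp_continuous_on differentiable_imp_continuous_within)
next
  case (Suc k)
  then show ?case
    unfolding Ck_on.simps(2)[of "Suc k"] Ck_on.simps(2)[of k f] by blast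
qed

lemma Ck_on_Suc_has_derivative:
  "Ck_on (Suc k) f U \<Longrightarrow> x \<in> U \<Longrightarrow> (f has_derivative frechet_derivative f (at x)) (at x)"
  by (simp add: frechet_derivative_works)

lemma Ck_on_Suc_frechet_derivative:
  "Ck_on (Suc k) f U \<Longrightarrow> Ck_on k (\<lambda>x. frechet_derivative f (at x) v) U"
  by simp

lemma Ck_on_bounded_linear:
  assumes "bounded_linear h" "open U" "Ck_on k f U"
  shows "Ck_on k (\<lambda>x. h (f x)) U"
  using assms(3)
proof (induction k arbitrary: f)
  case 0
  then show ?case by (simp add: bounded_linear.continuous_on[OF assms(1)])
next
  case (Suc k)
  show ?case
    by (rule Ck_on_SucI[OF \<open>open U\<close> bounded_linear.has_derivative[OF assms(1)]])
      (use Suc in \<open>auto intro: Ck_on_Suc_has_derivative\<close>)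
qed

lemma Ck_on_add:
  assumes "open U" "Ck_on k f U" "Ck_on k g U"
  shows "Ck_on k (\<lambda>x. f x + g x) U"
  using assms(2,3)
proof (induction k arbitrary: f g)
  case 0
  then show ?case by (simp add: continuous_on_add)
next
  case (Suc k)
  show ?case
    by (rule Ck_on_SucI[OF \<open>open U\<close> has_derivative_add])
      (use Suc in \<open>auto intro: Ck_on_Suc_has_derivative\<close>)
qed

text \<open>By the product rule the derivative is a sum of two values of \<open>b\<close>, each with
  one factor differentiated; the other factor is lowered to order \<open>k\<close> by
  \<open>Ck_on_Suc_imp_Ck_on\<close>.\<close>

lemma Ck_on_bounded_bilinear:
  assumes "bounded_bilinear b" "open U" "Ck_on k f U" "Ck_on k g U"
  shows "Ck_on k (\<lambda>x. b (f x) (g x)) U"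
  using assms(3,4)
proof (induction k arbitrary: f g)
  case 0
  then show ?case by (simp add: bounded_bilinear.continuous_on[OF assms(1)])
next
  case (Suc k)
  show ?case
    by (rule Ck_on_SucI[OF \<open>open U\<close> bounded_bilinear.FDERIV[OF assms(1)]])
      (use Suc in \<open>auto intro!: Ck_on_add[OF \<open>open U\<close>] Suc.IH
        intro: Ck_on_Suc_has_derivative Ck_on_Suc_imp_Ck_on Ck_on_Suc_frechet_derivative\<close>)
qed

lemma smooth_on_cong:
  "open U \<Longrightarrow> (\<And>x. x \<in> U \<Longrightarrow> f x = g x) \<Longrightarrow> smooth_on f U \<Longrightarrow> smooth_on g U"
  unfolding smooth_on_def using Ck_on_cong by blast

lemma smooth_on_bounded_linear:
  "bounded_linear h \<Longrightarrow> open U \<Longrightarrow> smooth_on f U \<Longrightarrow> smooth_on (\<lambda>x. h (f x)) U"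
  unfolding smooth_on_def using Ck_on_bounded_linear by blast

lemma smooth_on_mult:
  fixes f g :: "'a::real_normed_vector \<Rightarrow> 'b::real_normed_algebra"
  shows "open U \<Longrightarrow> smooth_on f U \<Longrightarrow> smooth_on g U \<Longrightarrow> smooth_on (\<lambda>x. f x * g x) U"
  unfolding smooth_on_def using Ck_on_bounded_bilinear[OF bounded_bilinear_mult] by blast

lemma smooth_on_diff:
  assumes "open U" "smooth_on f U" "smooth_on g U"
  shows "smooth_on (\<lambda>x. f x - g x) U"
  using Ck_on_add[OF \<open>open U\<close>, of _ f "\<lambda>x. - g x"]
    Ck_on_bounded_linear[OF bounded_linear_minus[OF bounded_linear_ident] \<open>open U\<close>, of _ g] assms
  by (simp add: smooth_on_def)

lemma smooth_on_has_derivative: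
  "smooth_on f U \<Longrightarrow> x \<in> U \<Longrightarrow> (f has_derivative frechet_derivative f (at x)) (at x)"
  unfolding smooth_on_def using Ck_on_Suc_has_derivative by blast

lemma smooth_on_frechet_derivative:
  "smooth_on f U \<Longrightarrow> smooth_on (\<lambda>x. frechet_derivative f (at x) v) U"
  unfolding smooth_on_def using Ck_on_Suc_frechet_derivative by blast

section \<open>Partial derivatives and the Frechet derivative\<close>

text \<open>Chain rule along the horizontal line through \<open>z\<close>, whose velocity is
  \<open>1\<close>.\<close>

lemma partial_x_eq:
  assumes "(G has_derivative G') (at z)"
  shows "partial_x G z = G' 1"
proof -
  have "((\<lambda>t. z + of_real t) has_derivative (\<lambda>t. of_real t)) (at 0)"
    by (auto intro!: derivative_eq_intros)
  from has_derivative_compose[OF this, of G G'] assms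
  have "((\<lambda>t. G (z + of_real t)) has_derivative (\<lambda>t. G' (of_real t))) (at 0)"
    by simp
  moreover have "G' (of_real t) = t *\<^sub>R G' 1" for t
    using linear_scale[OF has_derivative_linear[OF assms], of t 1] by (simp add: scaleR_conv_of_real)
  ultimately show ?thesis
    unfolding partial_x_def by (intro vector_derivative_at) (simp add: has_vector_derivative_def)
qed

lemma partial_y_eq:
  assumes "(G has_derivative G') (at z)"
  shows "partial_y G z = G' \<i>"
proof -
  have "((\<lambda>t. z + \<i> * of_real t) has_derivative (\<lambda>t. \<i> * of_real t)) (at 0)"
    by (auto intro!: derivative_eq_intros)
  from has_derivative_compose[OF this, of G G'] assms
  have "((\<lambda>t. G (z + \<i> * of_real t)) has_derivative (\<lambda>t. G' (\<i> * of_real t))) (at 0)"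
    by simp
  moreover have "G' (\<i> * of_real t) = t *\<^sub>R G' \<i>" for t
    using linear_scale[OF has_derivative_linear[OF assms], of t \<i>]
    by (simp add: scaleR_conv_of_real mult.commute)
  ultimately show ?thesis
    unfolding partial_y_def by (intro vector_derivative_at) (simp add: has_vector_derivative_def)
qed

text \<open>Real linearity of \<open>G'\<close> in the basis \<open>1\<close>, \<open>\<i>\<close>;
  with \<open>Complex p q\<close> the velocity of a curve, this is what the chain rule yields in
  coordinates.\<close>

lemma has_derivative_Complex:
  assumes "(G has_derivative G') (at z)"
  shows "G' (Complex p q) = p *\<^sub>R partial_x G z + q *\<^sub>R partial_y G z"
proof -
  interpret G': linear G' using assms by (rule has_derivative_linear)
  have "Complex p q = p *\<^sub>R 1 + q *\<^sub>R \<i>" by (simp add: complex_eq_iff)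
  then show ?thesis
    by (simp only: G'.add G'.scale partial_x_eq[OF assms] partial_y_eq[OF assms])
qed

text \<open>On \<open>U\<close> the partials are the Frechet derivative applied to the fixed vectors
  \<open>1\<close> and \<open>\<i>\<close>.\<close>

lemma smooth_on_partial:
  assumes "open U" "smooth_on G U"
  shows "smooth_on (partial_x G) U" "smooth_on (partial_y G) U"
proof -
  show "smooth_on (partial_x G) U"
    by (rule smooth_on_cong[OF assms(1) _ smooth_on_frechet_derivative[OF assms(2), of 1]])
      (simp add: partial_x_eq[OF smooth_on_has_derivative[OF assms(2)]])
  show "smooth_on (partial_y G) U"
    by (rule smooth_on_cong[OF assms(1) _ smooth_on_frechet_derivative[OF assms(2), of \<i>]])
      (simp add: partial_y_eq[OF smooth_on_has_derivative[OF assms(2)]])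
qed

lemma partial_bounded_linear:
  assumes "bounded_linear h" "(G has_derivative G') (at z)"
  shows "partial_x (\<lambda>w. h (G w)) z = h (partial_x G z)"
    and "partial_y (\<lambda>w. h (G w)) z = h (partial_y G z)"
  using bounded_linear.has_derivative[OF assms] assms(2) by (simp_all add: partial_x_eq partial_y_eq)

lemma has_derivative_imp_partial_cong:
  assumes "open U" "z \<in> U" "\<And>w. w \<in> U \<Longrightarrow> G w = H w" "(G has_derivative G') (at z)"
  shows "partial_x H z = partial_x G z" "partial_y H z = partial_y G z"
  using has_derivative_transform_within_open[OF assms(4,1-3)] assms(4)
  by (simp_all add: partial_x_eq partial_y_eq)

section \<open>The Jacobian and the two recursions\<close>

lemma jacobian_det_eq:
  "jacobian_det f z = partial_x (\<lambda>w. Re (f w)) z * partial_y (\<lambda>w. Im (f w)) z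
    - partial_y (\<lambda>w. Re (f w)) z * partial_x (\<lambda>w. Im (f w)) z"
  by (simp add: jacobian_det_def det_2)

lemma smooth_on_jacobian_det:
  assumes "open U" "smooth_on f U"
  shows "smooth_on (jacobian_det f) U"
  unfolding jacobian_det_eq[abs_def]
  by (intro smooth_on_diff smooth_on_mult smooth_on_partial
      smooth_on_bounded_linear[OF bounded_linear_Re] smooth_on_bounded_linear[OF bounded_linear_Im] assms)

lemma M_Suc:
  assumes "open U" "smooth_on f U" "z \<in> U"
  shows "M f (Suc n) z = of_real (partial_x (jacobian_det f) z) * partial_y (M f n) z
    - of_real (partial_y (jacobian_det f) z) * partial_x (M f n) z"
  using partial_bounded_linear[OF bounded_linear_of_real[where ?'a = complex]
      smooth_on_has_derivative[OF smooth_on_jacobian_det[OF assms(1,2)] assms(3)]]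
  by (simp add: det_2 grad_real_def)

text \<open>The Wirtinger determinant of \<open>G\<close>, \<open>H\<close> is
  \<open>\<i> / 2\<close> times the real determinant \<open>G_x H_y - G_y H_x\<close>. The factor
  \<open>2 * \<i>\<close> turns this into \<open>-1\<close>, which undoes the opposite order of rows
  in \<open>L\<close> and \<open>M\<close>.\<close>

lemma L_Suc:
  assumes "open U" "smooth_on f U" "z \<in> U"
  shows "2 * \<i> * L f (Suc n) z = of_real (partial_x (jacobian_det f) z) * partial_y (L f n) z
    - of_real (partial_y (jacobian_det f) z) * partial_x (L f n) z"
  using partial_bounded_linear[OF bounded_linear_of_real[where ?'a = complex]
      smooth_on_has_derivative[OF smooth_on_jacobian_det[OF assms(1,2)] assms(3)]]
  by (simp add: det_2 grad_wirtinger_def field_simps)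

lemma smooth_on_M:
  assumes "open U" "smooth_on f U"
  shows "smooth_on (M f n) U"
proof (induction n)
  case 0
  then show ?case using assms by simp
next
  case (Suc n)
  note J = smooth_on_partial[OF assms(1) smooth_on_jacobian_det[OF assms]]
  show ?case
    \<comment> \<open>The formula of \<open>M_Suc\<close> is available only at points of
      \<open>U\<close>, hence the congruence rule instead of rewriting.\<close>
    by (rule smooth_on_cong[OF assms(1) M_Suc[OF assms, symmetric]])
      (assumption | intro smooth_on_diff smooth_on_mult smooth_on_partial Suc.IH assms(1)
        smooth_on_bounded_linear[OF bounded_linear_of_real] J)+
qed

text \<open>By \<open>M_Suc\<close> and \<open>L_Suc\<close> each step contributes one factor
  \<open>2 * \<i>\<close>, and the constant accumulated so far passes through the partials. The
  point \<open>z\<close> varies in the induction because differentiating the identity needs it on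
  all of \<open>U\<close>.\<close>

lemma M_eq_L:
  assumes "open U" "smooth_on f U" "z \<in> U"
  shows "M f n z = (2 * \<i>) ^ n * L f n z"
  using assms(3)
proof (induction n arbitrary: z)
  case 0
  then show ?case by simp
next
  case (Suc n)
  let ?c = "(2 * \<i>) ^ n"
  \<comment> \<open>Solved for \<open>L f n\<close>, so that its differentiability is inherited from
    \<open>M f n\<close> and no separate smoothness proof for \<open>L\<close> is required.\<close>
  have L: "inverse ?c * M f n w = L f n w" if "w \<in> U" for w
    using Suc.IH[OF that] by (simp add: field_simps)
  have dM: "(M f n has_derivative frechet_derivative (M f n) (at z)) (at z)"
    using smooth_on_has_derivative smooth_on_M assms(1,2) Suc.prems by blast
  note dL = has_derivative_imp_partial_cong[OF assms(1) Suc.prems L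
      bounded_linear.has_derivative[OF bounded_linear_mult_right dM]]
  have p: "partial_x (M f n) z = ?c * partial_x (L f n) z"
    "partial_y (M f n) z = ?c * partial_y (L f n) z"
    using partial_bounded_linear[OF bounded_linear_mult_right dM, of "inverse ?c"] dL
    by (simp_all add: field_simps)
  have "M f (Suc n) z = ?c * (2 * \<i> * L f (Suc n) z)"
    unfolding M_Suc[OF assms(1,2) Suc.prems] L_Suc[OF assms(1,2) Suc.prems] p
    by (simp add: algebra_simps)
  then show ?case by (simp only: power_Suc2 mult.assoc)
qed

section \<open>Differentiation along the trajectory\<close>

lemma has_vector_derivative_M_trajectory:
  assumes "open U" "smooth_on f U" "\<Gamma> t \<in> U"
    and "(\<Gamma> has_vector_derivative
      Complex (- partial_y (jacobian_det f) (\<Gamma> t)) (partial_x (jacobian_det f) (\<Gamma> t))) (at t)"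
  shows "((\<lambda>s. M f n (\<Gamma> s)) has_vector_derivative M f (Suc n) (\<Gamma> t)) (at t)"
proof -
  let ?D = "frechet_derivative (M f n) (at (\<Gamma> t))"
  have D: "(M f n has_derivative ?D) (at (\<Gamma> t))"
    using smooth_on_has_derivative smooth_on_M assms(1-3) by blast
  have "((\<lambda>s. M f n (\<Gamma> s)) has_vector_derivative
      ?D (Complex (- partial_y (jacobian_det f) (\<Gamma> t)) (partial_x (jacobian_det f) (\<Gamma> t)))) (at t)"
    using vector_derivative_diff_chain_within[OF assms(4) has_derivative_at_withinI[OF D]]
    by (simp add: o_def)
  then show ?thesis
    unfolding has_derivative_Complex[OF D] M_Suc[OF assms(1-3)]
    by (simp add: scaleR_conv_of_real del: M.simps)
qed

text \<open>\<open>vector_derivative\<close> has a value even where no derivative exists; the second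
  claim therefore records existence, which gives the differentiability part of the theorem.\<close>

lemma trajectory_has_vector_derivative:
  assumes "open U" "smooth_on f U"
    and "trajectory_on (\<lambda>z. Complex (- partial_y (jacobian_det f) z) (partial_x (jacobian_det f) z)) U a I \<Gamma>"
    and "t \<in> I"
  shows "nth_vector_derivative n (\<lambda>s. f (\<Gamma> s)) t = M f n (\<Gamma> t)"
    and "(nth_vector_derivative n (\<lambda>s. f (\<Gamma> s)) has_vector_derivative M f (Suc n) (\<Gamma> t)) (at t)"
proof -
  have I: "open I" and M: "\<And>n t. t \<in> I \<Longrightarrow>
      ((\<lambda>s. M f n (\<Gamma> s)) has_vector_derivative M f (Suc n) (\<Gamma> t)) (at t)"
    using assms(3) has_vector_derivative_M_trajectory[OF assms(1,2)]
    by (auto simp: trajectory_on_def simp del: M.simps)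
  \<comment> \<open>Equality on the whole open set \<open>I\<close> is assumed, since equality at
    \<open>t\<close> alone would not transfer the derivative. The step serves both the induction for
    \<open>eq\<close> and the second claim.\<close>
  have step: "(nth_vector_derivative n (\<lambda>s. f (\<Gamma> s)) has_vector_derivative M f (Suc n) (\<Gamma> t)) (at t)"
    if "t \<in> I" "\<And>t. t \<in> I \<Longrightarrow> nth_vector_derivative n (\<lambda>s. f (\<Gamma> s)) t = M f n (\<Gamma> t)" for n t
    by (rule has_vector_derivative_transform_within_open[OF M I]) (use that in auto)
  have eq: "nth_vector_derivative n (\<lambda>s. f (\<Gamma> s)) t = M f n (\<Gamma> t)" if "t \<in> I" for n t
    using that
  proof (induction n arbitrary: t)
    case 0
    then show ?case by simp
  next
    case (Suc n)
    show ?case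
      using vector_derivative_at[OF step[OF Suc.prems Suc.IH]] by (simp del: M.simps)
  qed
  show "nth_vector_derivative n (\<lambda>s. f (\<Gamma> s)) t = M f n (\<Gamma> t)"
    using eq \<open>t \<in> I\<close> by blast
  show "(nth_vector_derivative n (\<lambda>s. f (\<Gamma> s)) has_vector_derivative M f (Suc n) (\<Gamma> t)) (at t)"
    using step[OF \<open>t \<in> I\<close> eq] by blast
qed

theorem propositionA2:
  fixes f :: "complex \<Rightarrow> complex" and a :: complex and U :: "complex set"
  assumes "open U" and "a \<in> U" and "smooth_on f U"
  shows "(\<forall>n\<ge>1. \<forall>z\<in>U. M f n z = (2 * \<i>) ^ n * L f n z) \<and>
    (\<forall>I \<Gamma>. trajectory_on (\<lambda>z. Complex (- partial_y (jacobian_det f) z) (partial_x (jacobian_det f) z)) U a I \<Gamma> \<longrightarrow>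
      (\<forall>n\<ge>1. \<forall>t\<in>I.
         (\<forall>m<n. nth_vector_derivative m (\<lambda>s. f (\<Gamma> s)) differentiable (at t)) \<and>
         nth_vector_derivative n (\<lambda>s. f (\<Gamma> s)) t = M f n (\<Gamma> t) \<and>
         M f n (\<Gamma> t) = (2 * \<i>) ^ n * L f n (\<Gamma> t)) \<and>
      (\<forall>n\<ge>1. nth_vector_derivative n (\<lambda>s. f (\<Gamma> s)) 0 = M f n a \<and>
         M f n a = (2 * \<i>) ^ n * L f n a))"
proof (intro conjI allI impI ballI)
  note S = assms(1,3)
  show "M f n z = (2 * \<i>) ^ n * L f n z" if "z \<in> U" for n z
    using M_eq_L[OF S that] .
  fix I \<Gamma>
  assume T: "trajectory_on (\<lambda>z. Complex (- partial_y (jacobian_det f) z) (partial_x (jacobian_det f) z)) U a I \<Gamma>"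
  note D = trajectory_has_vector_derivative[OF S T]
  have I: "0 \<in> I" "\<Gamma> 0 = a" "\<And>t. t \<in> I \<Longrightarrow> \<Gamma> t \<in> U"
    using T by (auto simp: trajectory_on_def)
  fix n
  show "nth_vector_derivative n (\<lambda>s. f (\<Gamma> s)) 0 = M f n a"
    using D(1)[OF I(1)] I(2) by simp
  show "M f n a = (2 * \<i>) ^ n * L f n a"
    using M_eq_L[OF S assms(2)] .
  fix t assume "t \<in> I"
  show "nth_vector_derivative n (\<lambda>s. f (\<Gamma> s)) t = M f n (\<Gamma> t)"
    using D(1)[OF \<open>t \<in> I\<close>] .
  show "M f n (\<Gamma> t) = (2 * \<i>) ^ n * L f n (\<Gamma> t)"
    using M_eq_L[OF S I(3)[OF \<open>t \<in> I\<close>]] .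
  show "nth_vector_derivative m (\<lambda>s. f (\<Gamma> s)) differentiable (at t)" for m
    using D(2)[OF \<open>t \<in> I\<close>] by (rule differentiableI_vector)
qed

end
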